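(* Let $X\in\mathbb{R}^{n\times p}$, let $F:\mathbb{R}^n\to\mathbb{R}$ be strictly convex and locally smooth, and let $G:\mathbb{R}^p\to\overline{\mathbb{R}}$ be proper, closed and convex, such that there are no lines along which $F$ or $G$ is finite and affine. Let $\Phi(\beta)=F(X\beta)+G(\beta)$ and $\Psi(\zeta)=-F^*(-\zeta)-G^*(X^\top\zeta)$, $\Phi^\star=\inf\Phi$, $\Psi^\star=\sup\Psi$. Assume there exist $\beta_s\in\mathbb{R}^p$ and $\zeta_s\in\mathbb{R}^n$ with $\beta_s\in\operatorname{ri}(\operatorname{dom}G)$, $X\beta_s\in\operatorname{int}(\operatorname{dom}F)$, $-\zeta_s\in\operatorname{int}(\operatorname{dom}F^* )$, $X^\top\zeta_s\in\operatorname{int}(\operatorname{dom}G^* )$ (so $\operatorname{ri}(\operatorname{dom}\Phi)$ and $\operatorname{int}(\operatorname{dom}\Psi)$ are nonempty). Let $\mathcal{B}^\star$ be the set of minimizers of $\Phi$ and $\zeta^\star$ the unique maximizer of $\Psi$. Assume further: (i) $\mathcal{B}^\star$ is compact and $X\mathcal{B}^\star\subset\operatorname{int}(\operatorname{dom}F)$; (ii) $F$ is firmly convex relative to $-\zeta^\star$ and $G$ is firmly convex relative to $X^\top\zeta^\star$; (iii) $\partial F^*(-\zeta^\star)$ and $\partial G^*(X^\top\zeta^\star)$ are polyhedral sets; (iv) $-\zeta^\star\in\operatorname{int}(\operatorname{dom}F^* )$ and $X^\top\zeta^\star\in\operatorname{int}(\operatorname{dom}G^* )$. Let $\mathcal{B}\subseteq\operatorname{dom}G$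 be compact with $\mathcal{B}^\star\subseteq\mathcal{B}$. Suppose a proximal first-order algorithm (relying on the proximal operator of $G$), started from an initial point $\beta^0\in\mathcal{B}$, generates a sequence $\{\beta^t\}_{t\ge0}\subset\mathcal{B}$ with associated dual sequence $\zeta^t:=-\nabla F(X\beta^t)$, and satisfies, for a rate function $r:\mathbb{N}\to\mathbb{R}_+$, $$\Phi(\beta^t)-\Phi^\star\le r(t)\cdot\operatorname{dist}^2(\beta^0,\mathcal{B}^\star)\qquad\forall t\ge1.$$ Let $\alpha_{\mathcal{B}},\sigma_{\mathcal{B}},\kappa_{\mathcal{B}}>0$ be geometric constants for $\mathcal{B}$, i.e. for all $\beta\in\mathcal{B}$ and $\zeta:=-\nabla F(X\beta)$: $\Phi(\beta)\ge\Phi^\star+\frac{\alpha_{\mathcal{B}}}{2}\operatorname{dist}^2(\beta,\mathcal{B}^\star)$, $\frac{\sigma_{\mathcal{B}}}{2}\|\zeta-\zeta^\star\|_2^2\le\Phi(\beta)-\Phi^\star$, and $\Psi(\zeta^\star)-\Psi(\zeta)\le\frac{\kappa_{\mathcal{B}}}{\sigma_{\mathcal{B}}}(\Phi(\beta)-\Phi^\star)$. Suppose $r$ is monotonically decreasing. Let $(\beta^{\mathrm{init}},\zeta^{\mathrm{init}})$ be the initial primal–dual pair ($\beta^{\mathrm{init}}\in\mathcal{B}$, $\zeta^{\mathrm{init}}=-\nabla F(X\beta^{\mathrm{init}})$). For any $\eta>1$ define $$t_{\max}:=\left\lceil r^{-1}\!\left(\frac{\alpha_{\mathcal{B}}}{2\eta(1+\kappa_{\mathcal{B}}/\sigma_{\mathcal{B}})}\right)\right\rceil.$$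 If the algorithm is restarted every $t_{\max}$ iterations (resetting $t=0$ and setting $\beta^0$ to the current iterate), then the duality gaps at the restart points satisfy, for every $s\in\mathbb{N}$, $$\Phi(\beta^{s\cdot t_{\max}})-\Psi(\zeta^{s\cdot t_{\max}})\le\eta^{-s}\left(\Phi(\beta^{\mathrm{init}})-\Psi(\zeta^{\mathrm{init}})\right).$$
   Context: Norms are Euclidean; $\overline{\mathbb{R}}=\mathbb{R}\cup\{\pm\infty\}$; $\operatorname{dist}(\beta,\mathcal{C})=\inf_{\gamma\in\mathcal{C}}\|\beta-\gamma\|_2$; $h^*(\alpha)=\sup_\beta\{\beta^\top\alpha-h(\beta)\}$ is the Fenchel conjugate; closed means closed epigraph. Locally smooth: $\nabla h$ exists and is Lipschitz continuous on every compact subset of $\operatorname{int}(\operatorname{dom}h)$. "There are no lines along which $h$ is finite and affine": there are no $x$ and $d\neq0$ such that $t\mapsto h(x+td)$ is finite and affine on $\mathbb{R}$. Firmly convex relative to $\nu$: a proper, closed, convex $h$ is firmly convex relative to $\nu$ if, with $h_\nu(\beta):=h(\beta)-\nu^\top\beta$, for any compact set $\mathcal{K}$ there is $\kappa>0$ with $h_\nu(\beta)\ge\inf h_\nu+\frac{\kappa}{2}\operatorname{dist}^2\big(\beta,(\partial h_\nu)^{-1}(0)\big)$ for all $\beta\in\mathcal{K}$. Here $(\partial h_\nu)^{-1}(0)$ is the set of minimizers of $h_\nu$. Under the convexity, smoothness, no-affine-line and Slater-point hypotheses, the primal and dual problems are solvable, $\Phi^\star=\Psi^\star$, and $\zeta^\star$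 is unique. Restarts: the rate guarantee of the algorithm holds for each run with respect to that run's own initial point. The restarted sequence has $\beta^{0}=\beta^{\mathrm{init}}$, and for each $s\ge0$, $\beta^{(s+1)t_{\max}}$ is the $t_{\max}$-th iterate of the algorithm run afresh from the initial point $\beta^{s\,t_{\max}}$; $\zeta^{s\,t_{\max}}=-\nabla F(X\beta^{s\,t_{\max}})$. Inverse of the rate function: $r$ is only defined on integers, so $\lceil r^{-1}(y)\rceil$ is read as the smallest integer $t\ge1$ with $r(t)\le y$ (assumed to exist for the $y$ used). *)

theory Defs
  imports "HOL-Analysis.Analysis"
begin

definition edom :: "('a \<Rightarrow> ereal) \<Rightarrow> 'a set" where
  "edom h = {x. h x < \<infinity>}"

definition epi :: "('a \<Rightarrow> ereal) \<Rightarrow> ('a \<times> real) set" where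
  "epi h = {(x, t). h x \<le> ereal t}"

definition proper_fun :: "('a \<Rightarrow> ereal) \<Rightarrow> bool" where
  "proper_fun h \<longleftrightarrow> (\<exists>x. h x < \<infinity>) \<and> (\<forall>x. h x \<noteq> -\<infinity>)"

definition closed_fun :: "('a::real_normed_vector \<Rightarrow> ereal) \<Rightarrow> bool" where
  "closed_fun h \<longleftrightarrow> closed (epi h)"

definition convex_fun :: "('a::real_normed_vector \<Rightarrow> ereal) \<Rightarrow> bool" where
  "convex_fun h \<longleftrightarrow> convex (epi h)"

definition strictly_convex :: "('a::real_vector \<Rightarrow> real) \<Rightarrow> bool" where
  "strictly_convex f \<longleftrightarrow>
     (\<forall>x y u. x \<noteq> y \<and> 0 < u \<and> u < 1 \<longrightarrow>
        f ((1 - u) *\<^sub>R x + u *\<^sub>R y) < (1 - u) * f x + u * f y)"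

definition no_affine_lines :: "('a::real_vector \<Rightarrow> ereal) \<Rightarrow> bool" where
  "no_affine_lines h \<longleftrightarrow>
     \<not> (\<exists>x d. d \<noteq> 0 \<and> (\<exists>a b::real. \<forall>t::real. h (x + t *\<^sub>R d) = ereal (a + b * t)))"

definition fenchel_conj :: "('a::real_inner \<Rightarrow> ereal) \<Rightarrow> 'a \<Rightarrow> ereal" where
  "fenchel_conj h \<alpha> = (SUP \<beta>. ereal (\<beta> \<bullet> \<alpha>) - h \<beta>)"

definition subdiff :: "('a::real_inner \<Rightarrow> ereal) \<Rightarrow> 'a \<Rightarrow> 'a set" where
  "subdiff h x = {g. \<forall>y. h x + ereal (g \<bullet> (y - x)) \<le> h y}"

definition argmin :: "('a \<Rightarrow> ereal) \<Rightarrow> 'a set" where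
  "argmin h = {x. \<forall>y. h x \<le> h y}"

definition argmax :: "('a \<Rightarrow> ereal) \<Rightarrow> 'a set" where
  "argmax h = {x. \<forall>y. h y \<le> h x}"

text \<open>Unlike \<^const>\<open>infdist\<close>, which is 0 for the empty set, this is the infimum in the
  extended reals, so the distance to the empty set is \<open>\<infinity>\<close>.\<close>

definition edist_set :: "'a::real_normed_vector \<Rightarrow> 'a set \<Rightarrow> ereal" where
  "edist_set \<beta> C = (INF \<gamma>\<in>C. ereal (norm (\<beta> - \<gamma>)))"

definition grad :: "('a::real_inner \<Rightarrow> real) \<Rightarrow> 'a \<Rightarrow> 'a" where
  "grad f x = (THE D. GDERIV f x :> D)"

definition locally_smooth :: "('a::real_inner \<Rightarrow> ereal) \<Rightarrow> bool" where
  "locally_smooth h \<longleftrightarrow>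
     (\<forall>x\<in>interior (edom h). \<exists>D. GDERIV (\<lambda>y. real_of_ereal (h y)) x :> D) \<and>
     (\<forall>K. compact K \<and> K \<subseteq> interior (edom h) \<longrightarrow>
        (\<exists>L. L-lipschitz_on K (grad (\<lambda>y. real_of_ereal (h y)))))"

definition tilt :: "('a::real_inner \<Rightarrow> ereal) \<Rightarrow> 'a \<Rightarrow> 'a \<Rightarrow> ereal" where
  "tilt h \<nu> \<beta> = h \<beta> - ereal (\<nu> \<bullet> \<beta>)"

text \<open>The set \<open>{x. 0 \<in> subdiff (tilt h \<nu>) x}\<close> is the preimage of 0 under the subdifferential
  mapping of the tilted function.\<close>

definition firmly_convex :: "('a::real_inner \<Rightarrow> ereal) \<Rightarrow> 'a \<Rightarrow> bool" where
  "firmly_convex h \<nu> \<longleftrightarrow>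
     proper_fun h \<and> closed_fun h \<and> convex_fun h \<and>
     (\<forall>K. compact K \<longrightarrow>
        (\<exists>\<kappa>>0. \<forall>\<beta>\<in>K.
           tilt h \<nu> \<beta> \<ge> (INF x. tilt h \<nu> x)
             + ereal (\<kappa> / 2) * (edist_set \<beta> {x. 0 \<in> subdiff (tilt h \<nu>) x})\<^sup>2))"

definition primal_obj ::
  "real^'p^'n \<Rightarrow> (real^'n \<Rightarrow> real) \<Rightarrow> (real^'p \<Rightarrow> ereal) \<Rightarrow> real^'p \<Rightarrow> ereal" where
  "primal_obj X F G \<beta> = ereal (F (X *v \<beta>)) + G \<beta>"

definition dual_obj ::
  "real^'p^'n \<Rightarrow> (real^'n \<Rightarrow> real) \<Rightarrow> (real^'p \<Rightarrow> ereal) \<Rightarrow> real^'n \<Rightarrow> ereal" where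
  "dual_obj X F G \<zeta> =
     - fenchel_conj (\<lambda>v. ereal (F v)) (- \<zeta>) - fenchel_conj G (transpose X *v \<zeta>)"

definition primal_val ::
  "real^'p^'n \<Rightarrow> (real^'n \<Rightarrow> real) \<Rightarrow> (real^'p \<Rightarrow> ereal) \<Rightarrow> ereal" where
  "primal_val X F G = (INF \<beta>. primal_obj X F G \<beta>)"

definition dual_point :: "real^'p^'n \<Rightarrow> (real^'n \<Rightarrow> real) \<Rightarrow> real^'p \<Rightarrow> real^'n" where
  "dual_point X F \<beta> = - grad F (X *v \<beta>)"

text \<open>An algorithm is represented by its iteration map: \<open>alg b t\<close> is the iterate number \<open>t\<close> of
  the run started at \<open>b\<close>.  Every run started in the working set \<open>B\<close> stays in \<open>B\<close> and satisfies
  the rate guarantee with respect to its own initial point.\<close>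

definition has_rate ::
  "('a::real_normed_vector \<Rightarrow> ereal) \<Rightarrow> 'a set \<Rightarrow> ('a \<Rightarrow> nat \<Rightarrow> 'a) \<Rightarrow> (nat \<Rightarrow> real) \<Rightarrow> bool" where
  "has_rate \<Phi> B alg r \<longleftrightarrow>
     (\<forall>b\<in>B. alg b 0 = b \<and> (\<forall>t. alg b t \<in> B) \<and>
        (\<forall>t\<ge>1. \<Phi> (alg b t) - (INF x. \<Phi> x) \<le> ereal (r t) * (edist_set b (argmin \<Phi>))\<^sup>2))"

definition geometric_constants ::
  "real^'p^'n \<Rightarrow> (real^'n \<Rightarrow> real) \<Rightarrow> (real^'p \<Rightarrow> ereal) \<Rightarrow> (real^'p) set \<Rightarrow> real^'n \<Rightarrow>
   real \<Rightarrow> real \<Rightarrow> real \<Rightarrow> bool" where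
  "geometric_constants X F G B \<zeta>s \<alpha> \<sigma> \<kappa> \<longleftrightarrow>
     \<alpha> > 0 \<and> \<sigma> > 0 \<and> \<kappa> > 0 \<and>
     (\<forall>\<beta>\<in>B.
        primal_obj X F G \<beta> \<ge> primal_val X F G
          + ereal (\<alpha> / 2) * (edist_set \<beta> (argmin (primal_obj X F G)))\<^sup>2 \<and>
        ereal (\<sigma> / 2 * (norm (dual_point X F \<beta> - \<zeta>s))\<^sup>2) \<le> primal_obj X F G \<beta> - primal_val X F G \<and>
        dual_obj X F G \<zeta>s - dual_obj X F G (dual_point X F \<beta>)
          \<le> ereal (\<kappa> / \<sigma>) * (primal_obj X F G \<beta> - primal_val X F G))"

text \<open>The rate function lives on the integers, so the rounded-up inverse at \<open>y\<close> is the least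
  \<open>t \<ge> 1\<close> with \<open>r t \<le> y\<close>; it is meaningful only if such a \<open>t\<close> exists.\<close>

definition rate_inv :: "(nat \<Rightarrow> real) \<Rightarrow> real \<Rightarrow> nat" where
  "rate_inv r y = (LEAST t. 1 \<le> t \<and> r t \<le> y)"

text \<open>\<open>x\<close> is the restarted iterate sequence; only its values at the restart points
  \<open>s * T\<close> are constrained.\<close>

definition restarted :: "('a \<Rightarrow> nat \<Rightarrow> 'a) \<Rightarrow> nat \<Rightarrow> 'a \<Rightarrow> (nat \<Rightarrow> 'a) \<Rightarrow> bool" where
  "restarted alg T b x \<longleftrightarrow> x 0 = b \<and> (\<forall>s. x ((s + 1) * T) = alg (x (s * T)) T)"

end

theory Submission
  imports Defs
begin

text \<open>Write \<open>\<Phi>\<close> and \<open>\<Psi>\<close> for the primal and dual objective.  The quadratic growth constant forces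
  \<open>\<Phi>\<close> to have a minimizer, and at a minimizer \<open>b\<close> the bound on the dual distance forces
  \<open>\<zeta>\<^sup>\<star> = -\<nabla>F(Xb)\<close>.  First-order optimality of \<open>b\<close> then gives equality in both Fenchel inequalities, so
  \<open>\<Phi>\<^sup>\<star> = \<Psi>(\<zeta>\<^sup>\<star>)\<close>.  Hence the duality gap at \<open>\<beta>\<close> lies between \<open>\<Phi>(\<beta>) - \<Phi>\<^sup>\<star>\<close> and
  \<open>(1 + \<kappa>/\<sigma>)(\<Phi>(\<beta>) - \<Phi>\<^sup>\<star>)\<close>, while the rate guarantee combined with quadratic growth shrinks
  \<open>\<Phi> - \<Phi>\<^sup>\<star>\<close> by the factor \<open>\<eta>(1 + \<kappa>/\<sigma>)\<close> in each run.\<close>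

text \<open>The difference quotients along \<open>d\<close> at \<open>0\<close> from the right tend
  to \<open>g \<bullet> d\<close>, and each is at most \<open>c\<close>. A one-sided limit is used
  because convexity controls only the points of a segment, \<open>0 < t < 1\<close>.\<close>

lemma GDERIV_inner_le:
  fixes f :: "'a::real_inner \<Rightarrow> real"
  assumes "GDERIV f x :> g"
    and bound: "\<And>t. 0 < t \<Longrightarrow> t < 1 \<Longrightarrow> f (x + t *\<^sub>R d) - f x \<le> t * c"
  shows "g \<bullet> d \<le> c"
proof -
  have f: "(f has_derivative (\<lambda>h. h \<bullet> g)) (at (x + 0 *\<^sub>R d))"
    using assms(1) by (simp add: gderiv_def)
  have "((\<lambda>t. f (x + t *\<^sub>R d)) has_derivative (\<lambda>t. (t *\<^sub>R d) \<bullet> g)) (at 0)"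
    by (rule has_derivative_compose[where f = "\<lambda>t. x + t *\<^sub>R d" and g = f, OF _ f]) (auto intro!: derivative_eq_intros)
  then have "((\<lambda>t. f (x + t *\<^sub>R d)) has_field_derivative (d \<bullet> g)) (at 0)"
    by (simp add: has_field_derivative_def mult.commute[of _ "d \<bullet> g"])
  then have "((\<lambda>t. (f (x + t *\<^sub>R d) - f x) / t) \<longlongrightarrow> d \<bullet> g) (at_right 0)"
    by (auto simp: has_field_derivative_iff intro: filterlim_mono[OF _ order_refl at_le])
  moreover have "\<forall>\<^sub>F t in at_right 0. (f (x + t *\<^sub>R d) - f x) / t \<le> c"
    using eventually_at_right_real[OF zero_less_one]
    by eventually_elim (use bound in \<open>auto simp: divide_simps mult.commute\<close>)
  ultimately show ?thesis
    by (auto simp: inner_commute intro: tendsto_upperbound)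
qed

lemma GDERIV_inner_ge:
  fixes f :: "'a::real_inner \<Rightarrow> real"
  assumes "GDERIV f x :> g"
    and "\<And>t. 0 < t \<Longrightarrow> t < 1 \<Longrightarrow> t * c \<le> f (x + t *\<^sub>R d) - f x"
  shows "c \<le> g \<bullet> d"
  using GDERIV_inner_le[OF GDERIV_minus[OF assms(1)], of d "- c"] assms(2) by force

lemma grad_eq:
  assumes "GDERIV f x :> g"
  shows "grad f x = g"
proof -
  have "D = g" if "GDERIV f x :> D" for D
  proof -
    have "(\<lambda>h. h \<bullet> D) = (\<lambda>h. h \<bullet> g)"
      using that assms unfolding gderiv_def by (rule has_derivative_unique)
    \<comment> \<open>Testing the two equal linear forms at \<open>D - g\<close> makes its squared
      norm vanish.\<close>
    then have "(D - g) \<bullet> D = (D - g) \<bullet> g" by metis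
    then have "(D - g) \<bullet> (D - g) = 0" by (simp add: inner_diff_right)
    then show ?thesis by simp
  qed
  then show ?thesis unfolding grad_def using assms by blast
qed

text \<open>A real-valued \<open>f\<close> has the whole space as effective domain, so local
  smoothness yields a gradient at every point.\<close>

lemma GDERIV_grad:
  assumes "locally_smooth (\<lambda>v. ereal (f v))"
  shows "GDERIV f x :> grad f x"
  using assms grad_eq by (fastforce simp: locally_smooth_def edom_def)

text \<open>The chord bound caps the difference quotients towards \<open>y\<close> by
  \<open>f y - f x\<close>. Equal points are split off because strict convexity speaks only of
  distinct ones.\<close>

lemma strictly_convex_gradient_inequality:
  fixes f :: "'a::real_inner \<Rightarrow> real"
  assumes "strictly_convex f" and "GDERIV f x :> g"
  shows "f x + g \<bullet> (y - x) \<le> f y"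
proof (cases "x = y")
  case False
  have "g \<bullet> (y - x) \<le> f y - f x"
  proof (rule GDERIV_inner_le[OF assms(2)])
    fix t :: real assume t: "0 < t" "t < 1"
    have "f ((1 - t) *\<^sub>R x + t *\<^sub>R y) < (1 - t) * f x + t * f y"
      using assms(1) False t by (auto simp: strictly_convex_def)
    moreover have "(1 - t) *\<^sub>R x + t *\<^sub>R y = x + t *\<^sub>R (y - x)"
      by (simp add: algebra_simps)
    ultimately show "f (x + t *\<^sub>R (y - x)) - f x \<le> t * (f y - f x)"
      by (simp add: algebra_simps)
  qed
  then show ?thesis by simp
qed simp

lemma convex_funD:
  assumes "convex_fun h" "h x = ereal a" "h y = ereal b" "0 \<le> t" "t \<le> 1"
  shows "h ((1 - t) *\<^sub>R x + t *\<^sub>R y) \<le> ereal ((1 - t) * a + t * b)"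
proof -
  have "(x, a) \<in> epi h" "(y, b) \<in> epi h" using assms by (auto simp: epi_def)
  then have "(1 - t) *\<^sub>R (x, a) + t *\<^sub>R (y, b) \<in> epi h"
    using assms unfolding convex_fun_def by (intro convexD) auto
  then show ?thesis by (simp add: epi_def)
qed

text \<open>Equality case of Fenchel-Young: the subgradient inequality says exactly that the
  supremum defining the conjugate is attained at \<open>x\<close>.\<close>

lemma fenchel_conj_eq:
  assumes "g \<in> subdiff h x" and "h x = ereal a"
  shows "fenchel_conj h g = ereal (x \<bullet> g - a)"
  unfolding fenchel_conj_def
proof (rule antisym)
  show "(SUP y. ereal (y \<bullet> g) - h y) \<le> ereal (x \<bullet> g - a)"
  proof (rule SUP_least)
    fix y
    have "ereal (a + g \<bullet> (y - x)) \<le> h y"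
      using assms by (auto simp: subdiff_def)
    then show "ereal (y \<bullet> g) - h y \<le> ereal (x \<bullet> g - a)"
      by (cases "h y") (auto simp: inner_diff_right inner_commute[of g])
  qed
  show "ereal (x \<bullet> g - a) \<le> (SUP y. ereal (y \<bullet> g) - h y)"
    by (rule SUP_upper2[of x]) (simp_all add: assms)
qed

lemma INF_eq_argmin: "x \<in> argmin h \<Longrightarrow> (INF y. h y) = h x"
  by (auto simp: argmin_def intro!: antisym INF_lower INF_greatest)

text \<open>Compare \<open>b\<close> with points of the segment towards \<open>y\<close>. Bounding
  \<open>G\<close> there by its chord, while keeping \<open>F\<close> exact, turns optimality into a
  lower bound on the increase of \<open>F\<close>; differentiating at \<open>b\<close> gives the
  subgradient inequality for \<open>G\<close>.\<close>

lemma primal_minimizer_subdiff: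
  fixes X :: "real^'p^'n"
  assumes F: "locally_smooth (\<lambda>v. ereal (F v))"
    and G: "proper_fun G" "convex_fun G"
    and b: "b \<in> argmin (primal_obj X F G)" and a: "G b = ereal a"
  shows "transpose X *v dual_point X F b \<in> subdiff G b"
  unfolding subdiff_def mem_Collect_eq
proof
  fix y
  show "G b + ereal ((transpose X *v dual_point X F b) \<bullet> (y - b)) \<le> G y"
  proof (cases "G y")
    case (real c)
    have "a - c \<le> grad F (X *v b) \<bullet> (X *v (y - b))"
    proof (rule GDERIV_inner_ge[OF GDERIV_grad[OF F]])
      fix t :: real assume t: "0 < t" "t < 1"
      define z where "z = (1 - t) *\<^sub>R b + t *\<^sub>R y"
      have Xz: "X *v z = X *v b + t *\<^sub>R (X *v (y - b))"
        by (simp add: z_def algebra_simps matrix_vector_mult_scaleR)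
      have "ereal (F (X *v b)) + ereal a \<le> ereal (F (X *v z)) + G z"
        using b a by (auto simp: argmin_def primal_obj_def)
      also have "\<dots> \<le> ereal (F (X *v z)) + ereal ((1 - t) * a + t * c)"
        unfolding z_def by (intro add_left_mono convex_funD[OF G(2) a real]) (use t in auto)
      finally show "t * (a - c) \<le> F (X *v b + t *\<^sub>R (X *v (y - b))) - F (X *v b)"
        by (simp add: Xz algebra_simps)
    qed
    moreover have "(transpose X *v dual_point X F b) \<bullet> (y - b)
        = - (grad F (X *v b) \<bullet> (X *v (y - b)))"
      by (simp add: dual_point_def dot_lmul_matrix)
    ultimately show ?thesis using real a by simp
  qed (use G in \<open>auto simp: proper_fun_def\<close>)
qed

text \<open>Both conjugates are attained, at \<open>X *v b\<close> and at \<open>b\<close>, and the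
  two inner products cancel because \<open>transpose X\<close> is the adjoint of
  \<open>X\<close>.\<close>

lemma dual_obj_dual_point:
  fixes X :: "real^'p^'n"
  assumes F: "strictly_convex F" "locally_smooth (\<lambda>v. ereal (F v))"
    and G: "proper_fun G" "convex_fun G"
    and b: "b \<in> argmin (primal_obj X F G)" and a: "G b = ereal a"
  shows "dual_obj X F G (dual_point X F b) = primal_obj X F G b"
proof -
  let ?g = "grad F (X *v b)"
  have "?g \<in> subdiff (\<lambda>v. ereal (F v)) (X *v b)"
    using strictly_convex_gradient_inequality[OF F(1) GDERIV_grad[OF F(2)]]
    by (simp add: subdiff_def)
  then have "fenchel_conj (\<lambda>v. ereal (F v)) ?g = ereal ((X *v b) \<bullet> ?g - F (X *v b))"
    by (rule fenchel_conj_eq) simp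
  moreover have "fenchel_conj G (transpose X *v dual_point X F b)
      = ereal (b \<bullet> (transpose X *v dual_point X F b) - a)"
    using primal_minimizer_subdiff[OF F(2) G b a] a by (rule fenchel_conj_eq)
  moreover have "b \<bullet> (transpose X *v dual_point X F b) = - ((X *v b) \<bullet> ?g)"
    by (simp add: dual_point_def inner_commute[of b] dot_lmul_matrix inner_commute[of ?g])
  ultimately show ?thesis
    by (simp add: dual_obj_def primal_obj_def a dual_point_def)
qed

theorem theorem3p12:
  fixes X :: "real^'p^'n"
    and F :: "real^'n \<Rightarrow> real"
    and G :: "real^'p \<Rightarrow> ereal"
    and B :: "(real^'p) set"
    and \<beta>s :: "real^'p"
    and \<zeta>s \<zeta>star :: "real^'n"
    and alg :: "real^'p \<Rightarrow> nat \<Rightarrow> real^'p"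
    and r :: "nat \<Rightarrow> real"
    and \<alpha> \<sigma> \<kappa> \<eta> :: real
    and tmax :: nat
    and \<beta>init :: "real^'p"
    and \<zeta>init :: "real^'n"
    and \<beta> :: "nat \<Rightarrow> real^'p"
    and \<zeta> :: "nat \<Rightarrow> real^'n"
  assumes "strictly_convex F" and "locally_smooth (\<lambda>v. ereal (F v))"
    and "proper_fun G" and "closed_fun G" and "convex_fun G"
    and "no_affine_lines (\<lambda>v. ereal (F v))" and "no_affine_lines G"
    and "\<beta>s \<in> rel_interior (edom G)"
    and "X *v \<beta>s \<in> interior (edom (\<lambda>v. ereal (F v)))"
    and "- \<zeta>s \<in> interior (edom (fenchel_conj (\<lambda>v. ereal (F v))))"
    and "transpose X *v \<zeta>s \<in> interior (edom (fenchel_conj G))"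
    and "argmax (dual_obj X F G) = {\<zeta>star}"
    and "compact (argmin (primal_obj X F G))"
    and "(\<lambda>b. X *v b) ` argmin (primal_obj X F G) \<subseteq> interior (edom (\<lambda>v. ereal (F v)))"
    and "firmly_convex (\<lambda>v. ereal (F v)) (- \<zeta>star)"
    and "firmly_convex G (transpose X *v \<zeta>star)"
    and "polyhedron (subdiff (fenchel_conj (\<lambda>v. ereal (F v))) (- \<zeta>star))"
    and "polyhedron (subdiff (fenchel_conj G) (transpose X *v \<zeta>star))"
    and "- \<zeta>star \<in> interior (edom (fenchel_conj (\<lambda>v. ereal (F v))))"
    and "transpose X *v \<zeta>star \<in> interior (edom (fenchel_conj G))"
    and "compact B" and "B \<subseteq> edom G" and "argmin (primal_obj X F G) \<subseteq> B"
    and "\<forall>t. 0 \<le> r t"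
    and "has_rate (primal_obj X F G) B alg r"
    and "geometric_constants X F G B \<zeta>star \<alpha> \<sigma> \<kappa>"
    and "monotone_on {1..} (\<le>) (\<ge>) r"
    and "\<beta>init \<in> B" and "\<zeta>init = dual_point X F \<beta>init"
    and "\<eta> > 1"
    and "\<exists>t\<ge>1. r t \<le> \<alpha> / (2 * \<eta> * (1 + \<kappa> / \<sigma>))"
    and "tmax = rate_inv r (\<alpha> / (2 * \<eta> * (1 + \<kappa> / \<sigma>)))"
    and "restarted alg tmax \<beta>init \<beta>"
    and "\<forall>s. \<zeta> (s * tmax) = dual_point X F (\<beta> (s * tmax))"
  shows "\<forall>s::nat. primal_obj X F G (\<beta> (s * tmax)) - dual_obj X F G (\<zeta> (s * tmax))
           \<le> ereal (1 / \<eta> ^ s) * (primal_obj X F G \<beta>init - dual_obj X F G \<zeta>init)"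
proof -
  let ?P = "primal_obj X F G" and ?D = "dual_obj X F G" and ?V = "primal_val X F G"
  let ?d = "\<lambda>b. edist_set b (argmin (primal_obj X F G))"
  define y where "y = \<alpha> / (2 * \<eta> * (1 + \<kappa> / \<sigma>))"
  note geom = assms(26)[unfolded geometric_constants_def]
  have pos: "\<alpha> > 0" "\<sigma> > 0" "\<kappa> > 0" using geom by auto
  have growth: "?P b \<ge> ?V + ereal (\<alpha> / 2) * (?d b)\<^sup>2"
    and distb: "ereal (\<sigma> / 2 * (norm (dual_point X F b - \<zeta>star))\<^sup>2) \<le> ?P b - ?V"
    and dualb: "?D \<zeta>star - ?D (dual_point X F b) \<le> ereal (\<kappa> / \<sigma>) * (?P b - ?V)"
    if "b \<in> B" for b
    using geom that by blast+
  have finG: "\<exists>a. G b = ereal a" if "b \<in> B" for b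
    using that \<open>B \<subseteq> edom G\<close> \<open>proper_fun G\<close>
    by (cases "G b") (auto simp: edom_def proper_fun_def)
  have "argmin ?P \<noteq> {}"
  proof
    assume "argmin ?P = {}"
    \<comment> \<open>The extended distance to the empty set is \<open>\<infinity>\<close>, so
      quadratic growth would make the objective infinite on \<open>B\<close>.\<close>
    then have "?P \<beta>init = \<infinity>"
      using growth[OF \<open>\<beta>init \<in> B\<close>] pos
      by (simp add: edist_set_def top_ereal_def power2_eq_square)
    then show False using finG[OF \<open>\<beta>init \<in> B\<close>] by (auto simp: primal_obj_def)
  qed
  then obtain b where b: "b \<in> argmin ?P" by blast
  then have bB: "b \<in> B" using assms by blast
  obtain a where a: "G b = ereal a" using finG[OF bB] by blast
  define v where "v = F (X *v b) + a"
  have Pb: "?P b = ereal v" by (simp add: primal_obj_def a v_def)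
  have V: "?V = ereal v" using INF_eq_argmin[OF b] Pb by (simp add: primal_val_def)
  have "\<sigma> / 2 * (norm (dual_point X F b - \<zeta>star))\<^sup>2 \<le> 0"
    using distb[OF bB] by (simp add: Pb V)
  then have "\<zeta>star = dual_point X F b"
    using pos by (simp add: mult_le_0_iff)
  then have Dstar: "?D \<zeta>star = ereal v"
    using dual_obj_dual_point[OF assms(1,2,3,5) b a] Pb by simp
  have Dle: "?D z \<le> ereal v" for z
    using equalityD2[OF assms(12)] Dstar by (auto simp: argmax_def)

  \<comment> \<open>This is the primal suboptimality, not the duality gap. Passing to reals is
    harmless on \<open>B\<close>, where the objective is finite.\<close>
  define gap where "gap c = real_of_ereal (?P c) - v" for c
  have P: "?P c = ereal (v + gap c)" if "c \<in> B" for c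
    using finG[OF that] by (auto simp: gap_def primal_obj_def)
  \<comment> \<open>A dual value of \<open>-\<infinity>\<close> makes the right-hand side infinite
    here; in \<open>upper\<close> it is excluded by the finite bound \<open>dualb\<close>.\<close>
  have lower: "ereal (gap c) \<le> ?P c - ?D (dual_point X F c)" if "c \<in> B" for c
    using P[OF that] Dle[of "dual_point X F c"] by (cases "?D (dual_point X F c)") auto
  have upper: "?P c - ?D (dual_point X F c) \<le> ereal ((1 + \<kappa> / \<sigma>) * gap c)" if "c \<in> B" for c
    using P[OF that] dualb[OF that] Dle[of "dual_point X F c"]
    by (cases "?D (dual_point X F c)") (auto simp: Dstar V algebra_simps)
  \<comment> \<open>Growth below a finite objective value forces the squared distance to be finite,
    so the remaining estimates can be made in the reals.\<close>
  have dist: "\<exists>e\<ge>0. (?d c)\<^sup>2 = ereal e \<and> \<alpha> / 2 * e \<le> gap c" if "c \<in> B" for c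
  proof -
    have "0 \<le> ?d c"
      by (auto simp: edist_set_def intro!: INF_greatest)
    then have "0 \<le> (?d c)\<^sup>2" by (simp add: power2_eq_square)
    then show ?thesis
      using growth[OF that] P[OF that] pos by (cases "(?d c)\<^sup>2") (auto simp: V)
  qed

  have "1 \<le> tmax \<and> r tmax \<le> y"
    unfolding assms(32) rate_inv_def y_def[symmetric]
    by (rule LeastI_ex) (use assms(31) in \<open>simp add: y_def\<close>)
  then have tmax: "1 \<le> tmax" "r tmax \<le> y" by auto
  have x0: "\<beta> 0 = \<beta>init" and xS: "\<beta> (Suc s * tmax) = alg (\<beta> (s * tmax)) tmax" for s
    using assms(33) by (auto simp: restarted_def)
  \<comment> \<open>Restart points stay in \<open>B\<close>, so the rate guarantee applies anew to
    each run.\<close>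
  have inB: "\<beta> (s * tmax) \<in> B" for s
  proof (induction s)
    case (Suc s)
    then show ?case using assms(25) by (simp only: xS has_rate_def)
  qed (simp add: x0 \<open>\<beta>init \<in> B\<close>)
  \<comment> \<open>The rate bounds the new suboptimality by \<open>y * e\<close>, and growth bounds
    \<open>\<alpha> / 2 * e\<close> by the old one. The denominator of \<open>y\<close> supplies
    both \<open>1 / \<eta>\<close> and the factor \<open>1 + \<kappa> / \<sigma>\<close> that
    \<open>upper\<close> costs.\<close>
  have step: "(1 + \<kappa> / \<sigma>) * gap (alg c tmax) \<le> gap c / \<eta>" if c: "c \<in> B" for c
  proof -
    obtain e where e: "e \<ge> 0" "(?d c)\<^sup>2 = ereal e" "\<alpha> / 2 * e \<le> gap c"
      using dist[OF c] by blast
    have "alg c tmax \<in> B" and "?P (alg c tmax) - ?V \<le> ereal (r tmax) * (?d c)\<^sup>2"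
      using assms(25) c tmax(1) by (auto simp: has_rate_def primal_val_def)
    then have "gap (alg c tmax) \<le> r tmax * e"
      using P e by (simp add: V)
    also have "\<dots> \<le> y * e" using tmax e by (intro mult_right_mono)
    finally have "(1 + \<kappa> / \<sigma>) * gap (alg c tmax) \<le> (1 + \<kappa> / \<sigma>) * (y * e)"
      using pos by (intro mult_left_mono) auto
    also have "\<dots> = ((1 + \<kappa> / \<sigma>) / (1 + \<kappa> / \<sigma>)) * (\<alpha> / 2 * e / \<eta>)"
      by (simp add: y_def)
    also have "\<dots> = \<alpha> / 2 * e / \<eta>"
      using pos by (subst divide_self) (auto simp: add_pos_pos less_imp_neq[symmetric])
    also have "\<dots> \<le> gap c / \<eta>" using e \<open>\<eta> > 1\<close> by (intro divide_right_mono) auto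
    finally show ?thesis .
  qed
  let ?g = "\<lambda>s. ?P (\<beta> (s * tmax)) - ?D (\<zeta> (s * tmax))"
  have z: "\<zeta> (s * tmax) = dual_point X F (\<beta> (s * tmax))" for s using assms(34) by blast
  show ?thesis
  proof
    fix s
    show "?g s \<le> ereal (1 / \<eta> ^ s) * (?P \<beta>init - ?D \<zeta>init)"
    proof (induction s)
      case 0
      show ?case using z[of 0] x0 assms(29) by (simp flip: one_ereal_def)
    next
      case (Suc s)
      have "?g (Suc s) \<le> ereal ((1 + \<kappa> / \<sigma>) * gap (\<beta> (Suc s * tmax)))"
        unfolding z by (rule upper[OF inB])
      also have "\<dots> \<le> ereal (1 / \<eta>) * ereal (gap (\<beta> (s * tmax)))"
        using step[OF inB[of s]] by (simp only: xS) simp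
      \<comment> \<open>Returning to the duality gap through \<open>lower\<close> costs no constant,
        so each run contracts by the full factor \<open>1 / \<eta>\<close>.\<close>
      also have "\<dots> \<le> ereal (1 / \<eta>) * ?g s"
        unfolding z using \<open>\<eta> > 1\<close> by (intro ereal_mult_left_mono lower inB) simp
      also have "\<dots> \<le> ereal (1 / \<eta>) * (ereal (1 / \<eta> ^ s) * (?P \<beta>init - ?D \<zeta>init))"
        using Suc \<open>\<eta> > 1\<close> by (intro ereal_mult_left_mono) auto
      also have "\<dots> = ereal (1 / \<eta> ^ Suc s) * (?P \<beta>init - ?D \<zeta>init)"
        by (simp flip: mult.assoc)
      finally show ?case .
    qed
  qed
qed

end
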